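(* Consider a cost function of the form $$C_n(x)=\sum_{k\in\mathbb{Z}_n}J_kx_kx_{k+1}\qquad\text{for }x\in\{1,-1\}^n,$$ where $J_k\in\{1,-1\}$ for all $k\in\mathbb{Z}_n$. Then the level-$1$ RQAOA produces $x^*\in\{1,-1\}^n$ such that $C_n(x^* )=\max_{x\in\{1,-1\}^n}C_n(x)$.
   Context: Indices are modulo $n$. The cost function corresponds to the Hamiltonian $H=\sum_{k\in\mathbb{Z}_n}J_kZ_kZ_{k+1}$ on $n$ qubits, where $Z_k$, $X_k$ are Pauli operators on qubit $k$. For an Ising Hamiltonian $H=\sum_{(i,j)\in E}J_{i,j}Z_iZ_j$ on a graph with $N$ vertices and edge set $E$, the level-$1$ QAOA states are $|\Psi_H(\beta,\gamma)\rangle=e^{i\beta B}e^{i\gamma H}|+\rangle^{\otimes N}$, $\beta,\gamma\in\mathbb{R}$, with $B=\sum_jX_j$. Level-$1$ RQAOA with threshold $n_c$ ($2\le n_c<n$): while the number of variables exceeds $n_c$, repeat the following for the current Ising Hamiltonian $H$. (1) Choose $(\beta^*,\gamma^* )\in\mathbb{R}^2$ maximizing $\langle\Psi_H(\beta,\gamma)|H|\Psi_H(\beta,\gamma)\rangle$ and compute $M_{i,j}=\langle\Psi_H(\beta^*,\gamma^* )|Z_iZ_j|\Psi_H(\beta^*,\gamma^* )\rangle$ for every $(i,j)\in E$. (2) Choose $(i,j)\in E$ with the largest $|M_{i,j}|$ (ties broken arbitrarily). (3) Impose the constraint $x_j=\mathrm{sgn}(M_{i,j})x_i$ and substitute it into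 the cost function to eliminate the variable $x_j$: terms $x_jx_k$ with $k\notin\{i,j\}$ become $\mathrm{sgn}(M_{i,j})x_ix_k$, the term $J_{i,j}x_ix_j$ becomes the constant $J_{i,j}\,\mathrm{sgn}(M_{i,j})$, and other terms are unchanged; this gives a new Ising cost function in one fewer variable (plus a constant). When $n_c$ variables remain, the remaining instance is maximized exactly (by brute force), and the eliminated variables are recovered from the imposed constraints; the resulting assignment is the output $x^*$. *)

theory Defs
  imports Complex_Main "HOL-Library.FuncSet"
begin

section \<open>Ising instances\<close>

text \<open>Spin assignments \<open>{1,-1}\<^sup>V\<close>, extended by \<open>undefined\<close> outside \<open>V\<close>.\<close>

definition spins :: "nat set \<Rightarrow> (nat \<Rightarrow> real) set" where
  "spins V = V \<rightarrow>\<^sub>E {1, -1}"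

text \<open>
  An Ising cost function on a simple graph. Edges are two-element sets of vertices, and
  \<open>weight {i, j}\<close> is the coupling \<open>J\<^sub>i\<^sub>j\<close>. The \<open>offset\<close> collects the additive constants
  produced by eliminating variables; it is not part of the Hamiltonian.
\<close>

record ising =
  verts :: "nat set"
  edges :: "nat set set"
  weight :: "nat set \<Rightarrow> real"
  offset :: real

definition cost :: "ising \<Rightarrow> (nat \<Rightarrow> real) \<Rightarrow> real" where
  "cost I x = offset I + (\<Sum>e\<in>edges I. weight I e * (\<Prod>v\<in>e. x v))"


section \<open>Qubits\<close>

text \<open>
  The space of qubits labelled by \<open>V\<close> is represented by amplitudes in the computational basis:
  \<open>\<psi> x\<close> is the coefficient of \<open>|x\<rangle>\<close> for \<open>x \<in> spins V\<close>, where the basis is labelled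
  by Z-eigenvalues, so that \<open>Z\<^sub>k|x\<rangle> = x\<^sub>k|x\<rangle>\<close> and \<open>X\<^sub>k\<close> flips the sign of \<open>x\<^sub>k\<close>.
\<close>

type_synonym state = "(nat \<Rightarrow> real) \<Rightarrow> complex"

definition pauliZ :: "nat \<Rightarrow> state \<Rightarrow> state" where
  "pauliZ k \<psi> = (\<lambda>x. complex_of_real (x k) * \<psi> x)"

definition pauliX :: "nat \<Rightarrow> state \<Rightarrow> state" where
  "pauliX k \<psi> = (\<lambda>x. \<psi> (x(k := - x k)))"

text \<open>The product of the operators \<open>Z\<^sub>v\<close> over \<open>v \<in> e\<close>; on an edge it is \<open>Z\<^sub>i Z\<^sub>j\<close>.\<close>

definition Z_prod :: "nat set \<Rightarrow> state \<Rightarrow> state" where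
  "Z_prod e \<psi> = (\<lambda>x. complex_of_real (\<Prod>v\<in>e. x v) * \<psi> x)"

lemma Z_prod_edge: "i \<noteq> j \<Longrightarrow> Z_prod {i, j} = pauliZ i \<circ> pauliZ j"
  by (simp add: Z_prod_def pauliZ_def fun_eq_iff)

definition hamiltonian :: "ising \<Rightarrow> state \<Rightarrow> state" where
  "hamiltonian I \<psi> = (\<lambda>x. \<Sum>e\<in>edges I. complex_of_real (weight I e) * Z_prod e \<psi> x)"

definition mixer :: "nat set \<Rightarrow> state \<Rightarrow> state" where
  "mixer V \<psi> = (\<lambda>x. \<Sum>j\<in>V. pauliX j \<psi> x)"

text \<open>The exponential \<open>exp (c A)\<close> of an operator, as a power series.\<close>

definition op_exp :: "complex \<Rightarrow> (state \<Rightarrow> state) \<Rightarrow> state \<Rightarrow> state" where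
  "op_exp c A \<psi> = (\<lambda>x. \<Sum>k. c ^ k / fact k * (A ^^ k) \<psi> x)"

definition plus_state :: "nat set \<Rightarrow> state" where
  "plus_state V = (\<lambda>x. if x \<in> spins V then complex_of_real ((1 / sqrt 2) ^ card V) else 0)"

text \<open>\<open>\<langle>\<psi>|A|\<psi>\<rangle>\<close>. It is used for self-adjoint \<open>A\<close> only, where the sum is real.\<close>

definition expect :: "nat set \<Rightarrow> state \<Rightarrow> (state \<Rightarrow> state) \<Rightarrow> real" where
  "expect V \<psi> A = Re (\<Sum>x\<in>spins V. cnj (\<psi> x) * A \<psi> x)"


section \<open>Level-1 QAOA and RQAOA\<close>

definition qaoa_state :: "ising \<Rightarrow> real \<Rightarrow> real \<Rightarrow> state" where
  "qaoa_state I \<beta> \<gamma> =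
     op_exp (\<i> * complex_of_real \<beta>) (mixer (verts I))
       (op_exp (\<i> * complex_of_real \<gamma>) (hamiltonian I) (plus_state (verts I)))"

definition qaoa_energy :: "ising \<Rightarrow> real \<Rightarrow> real \<Rightarrow> real" where
  "qaoa_energy I \<beta> \<gamma> = expect (verts I) (qaoa_state I \<beta> \<gamma>) (hamiltonian I)"

definition qaoa_optimal :: "ising \<Rightarrow> real \<Rightarrow> real \<Rightarrow> bool" where
  "qaoa_optimal I \<beta> \<gamma> \<longleftrightarrow> (\<forall>\<beta>' \<gamma>'. qaoa_energy I \<beta>' \<gamma>' \<le> qaoa_energy I \<beta> \<gamma>)"

definition correlation :: "ising \<Rightarrow> real \<Rightarrow> real \<Rightarrow> nat \<Rightarrow> nat \<Rightarrow> real" where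
  "correlation I \<beta> \<gamma> i j = expect (verts I) (qaoa_state I \<beta> \<gamma>) (pauliZ i \<circ> pauliZ j)"

text \<open>
  Substitution of \<open>x\<^sub>j = s x\<^sub>i\<close> along an edge \<open>{i, j}\<close>. If both \<open>{j, k}\<close> and \<open>{i, k}\<close> are
  edges, the two resulting terms in \<open>x\<^sub>i x\<^sub>k\<close> are added; the edge is kept even if its weight
  becomes zero.
\<close>

definition substitute :: "nat \<Rightarrow> nat \<Rightarrow> real \<Rightarrow> ising \<Rightarrow> ising" where
  "substitute i j s I =
     \<lparr> verts = verts I - {j},
       edges = {e \<in> edges I. j \<notin> e} \<union> {{i, k} |k. k \<notin> {i, j} \<and> {j, k} \<in> edges I},
       weight = (\<lambda>e. (if e \<in> edges I \<and> j \<notin> e then weight I e else 0)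
                   + (\<Sum>k | k \<notin> {i, j} \<and> {j, k} \<in> edges I \<and> e = {i, k}. s * weight I {j, k})),
       offset = offset I + s * weight I {i, j} \<rparr>"

text \<open>
  A state of the algorithm consists of the current instance and the constraints imposed so far,
  most recent first, where \<open>(i, j, s)\<close> stands for \<open>x\<^sub>j = s x\<^sub>i\<close>. A step is nondeterministic in
  the choice of the maximizer, of the edge among those of largest correlation, and of the endpoint
  of that edge which is eliminated.
\<close>

type_synonym rqaoa_state = "ising \<times> (nat \<times> nat \<times> real) list"

inductive rqaoa_step :: "nat \<Rightarrow> rqaoa_state \<Rightarrow> rqaoa_state \<Rightarrow> bool" for n_c :: nat where
  "\<lbrakk> card (verts I) > n_c;
     qaoa_optimal I \<beta> \<gamma>;
     i \<noteq> j; {i, j} \<in> edges I;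
     \<And>a b. \<lbrakk>a \<noteq> b; {a, b} \<in> edges I\<rbrakk> \<Longrightarrow> \<bar>correlation I \<beta> \<gamma> a b\<bar> \<le> \<bar>correlation I \<beta> \<gamma> i j\<bar>;
     s = sgn (correlation I \<beta> \<gamma> i j) \<rbrakk>
   \<Longrightarrow> rqaoa_step n_c (I, cs) (substitute i j s I, (i, j, s) # cs)"

fun recover :: "(nat \<times> nat \<times> real) list \<Rightarrow> (nat \<Rightarrow> real) \<Rightarrow> (nat \<Rightarrow> real)" where
  "recover [] y = y"
| "recover ((i, j, s) # cs) y = recover cs (y(j := s * y i))"

text \<open>\<open>x\<close> is a possible output of the algorithm when continued from the state \<open>S\<close>.\<close>

definition rqaoa_returns :: "nat \<Rightarrow> rqaoa_state \<Rightarrow> (nat \<Rightarrow> real) \<Rightarrow> bool" where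
  "rqaoa_returns n_c S x \<longleftrightarrow>
     (\<exists>I cs y. (rqaoa_step n_c)\<^sup>*\<^sup>* S (I, cs) \<and> card (verts I) \<le> n_c \<and>
        y \<in> spins (verts I) \<and> (\<forall>z\<in>spins (verts I). cost I z \<le> cost I y) \<and>
        x = recover cs y)"

definition rqaoa_start :: "ising \<Rightarrow> rqaoa_state" where
  "rqaoa_start I = (I, [])"


section \<open>The ring\<close>

text \<open>The elements of \<open>\<int>\<^sub>n\<close> are represented by \<open>0, \<dots>, n - 1\<close>.\<close>

definition ring_cost :: "nat \<Rightarrow> (nat \<Rightarrow> real) \<Rightarrow> (nat \<Rightarrow> real) \<Rightarrow> real" where
  "ring_cost n J x = (\<Sum>k<n. J k * x k * x (Suc k mod n))"

text \<open>For \<open>n \<ge> 3\<close> the sum defining the weight of an edge has exactly one term.\<close>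

definition ring_ising :: "nat \<Rightarrow> (nat \<Rightarrow> real) \<Rightarrow> ising" where
  "ring_ising n J =
     \<lparr> verts = {..<n},
       edges = {{k, Suc k mod n} |k. k < n},
       weight = (\<lambda>e. \<Sum>k | k < n \<and> e = {k, Suc k mod n}. J k),
       offset = 0 \<rparr>"

end

theory Submission
  imports Defs "HOL-Library.Multiset"
begin

text \<open>
  In the Heisenberg picture the mixer turns \<open>Z\<^sub>i Z\<^sub>j\<close> into an operator acting on the qubits \<open>i\<close> and
  \<open>j\<close> only, so the level-1 correlation along an edge \<open>e\<close> of a ring with couplings \<open>\<plusminus>1\<close> depends only
  on the couplings at the two ends of \<open>e\<close>. It equals \<open>J\<^sub>e g(\<beta>, \<gamma>)\<close> with \<open>g = 2 P Q + \<kappa> P\<^sup>2\<close>,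
  \<open>P = sin 2\<beta> sin 2\<gamma>\<close> and \<open>Q = cos 2\<beta> cos 2\<gamma>\<close>, where \<open>\<kappa>\<close> is the product of all couplings for a
  triangle and \<open>0\<close> for longer rings. The energy is therefore a positive multiple of \<open>g\<close>. Since
  \<open>\<bar>P\<bar> + \<bar>Q\<bar> \<le> 1\<close>, the maximum of \<open>g\<close> is \<open>1 / (2 - \<kappa>)\<close>,
  which is positive; hence at every optimum the correlation has the sign of the coupling, and RQAOA
  imposes \<open>x\<^sub>j = J\<^sub>e x\<^sub>i\<close>. Some maximizer satisfies this constraint: an assignment violating it does not
  get worse when \<open>x\<^sub>j\<close> is flipped. The contracted instance is again a ring with couplings \<open>\<plusminus>1\<close>,
  until two variables are left.
\<close>

section \<open>Time evolution under the mixer\<close>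

text \<open>\<open>exp (\<i> \<beta> X\<^sub>k)\<close> in closed form, as \<open>X\<^sub>k\<close>
  squares to the identity.\<close>

definition rot :: "real \<Rightarrow> nat \<Rightarrow> state \<Rightarrow> state" where
  "rot \<beta> k \<psi> = (\<lambda>x. complex_of_real (cos \<beta>) * \<psi> x + \<i> * complex_of_real (sin \<beta>) * pauliX k \<psi> x)"

text \<open>The scalar \<open>\<mu>\<close> generalizes the mixer for an induction over the qubits:
  it collects the eigenvalues of the flips already removed from \<open>K\<close>.\<close>

definition shifted_mixer :: "complex \<Rightarrow> nat set \<Rightarrow> state \<Rightarrow> state" where
  "shifted_mixer \<mu> K \<psi> = (\<lambda>x. \<mu> * \<psi> x + mixer K \<psi> x)"

lemma pauliX_pauliX [simp]: "pauliX k (pauliX k \<psi>) = \<psi>"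
  by (simp add: pauliX_def)

lemma pauliX_commute: "pauliX k (pauliX l \<psi>) = pauliX l (pauliX k \<psi>)"
  by (cases "k = l") (auto simp: pauliX_def fun_upd_twist)

lemma pauliX_lin: "pauliX k (\<lambda>x. a * f x + b * g x) = (\<lambda>x. a * pauliX k f x + b * pauliX k g x)"
  by (simp add: pauliX_def)

lemma shifted_mixer_lin:
  "shifted_mixer \<mu> K (\<lambda>x. a * f x + b * g x) =
     (\<lambda>x. a * shifted_mixer \<mu> K f x + b * shifted_mixer \<mu> K g x)"
  by (simp add: shifted_mixer_def mixer_def pauliX_lin sum.distrib sum_distrib_left algebra_simps)

lemma shifted_mixer_pow_lin:
  "(shifted_mixer \<mu> K ^^ n) (\<lambda>x. a * f x + b * g x) =
     (\<lambda>x. a * (shifted_mixer \<mu> K ^^ n) f x + b * (shifted_mixer \<mu> K ^^ n) g x)"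
  by (induction n) (simp_all add: shifted_mixer_lin)

lemma pauliX_shifted_mixer: "pauliX k (shifted_mixer \<mu> K \<psi>) = shifted_mixer \<mu> K (pauliX k \<psi>)"
proof -
  have "pauliX k (shifted_mixer \<mu> K \<psi>) x = \<mu> * pauliX k \<psi> x + (\<Sum>j\<in>K. pauliX k (pauliX j \<psi>) x)" for x
    by (simp add: pauliX_def[of k] shifted_mixer_def mixer_def)
  then show ?thesis
    by (simp add: fun_eq_iff pauliX_commute[of k] shifted_mixer_def mixer_def)
qed

lemma pauliX_shifted_mixer_pow:
  "pauliX k ((shifted_mixer \<mu> K ^^ n) \<psi>) = (shifted_mixer \<mu> K ^^ n) (pauliX k \<psi>)"
  by (induction n) (simp_all add: pauliX_shifted_mixer)

text \<open>\<open>pauliX k\<close> commutes with all flips, so every power keeps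
  \<open>\<psi>\<close> in the same eigenspace, where the summand \<open>pauliX k\<close> acts as
  the number \<open>\<epsilon>\<close>.\<close>

lemma shifted_mixer_pow_eigen:
  assumes "finite K" "k \<notin> K" and eig: "pauliX k \<psi> = (\<lambda>x. \<epsilon> * \<psi> x)"
  shows "(shifted_mixer \<mu> (insert k K) ^^ n) \<psi> = (shifted_mixer (\<mu> + \<epsilon>) K ^^ n) \<psi>"
proof (induction n)
  case (Suc n)
  let ?f = "(shifted_mixer (\<mu> + \<epsilon>) K ^^ n) \<psi>"
  have "pauliX k ?f = (\<lambda>x. \<epsilon> * ?f x)"
    using shifted_mixer_pow_lin[of n "\<mu> + \<epsilon>" K \<epsilon> \<psi> 0 \<psi>]
    by (simp add: pauliX_shifted_mixer_pow eig)
  then have "shifted_mixer \<mu> (insert k K) ?f = shifted_mixer (\<mu> + \<epsilon>) K ?f"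
    using assms(1,2) by (simp add: shifted_mixer_def mixer_def algebra_simps)
  then show ?case
    using Suc by simp
qed simp

lemma rot_lin: "rot \<beta> k (\<lambda>x. a * f x + b * g x) = (\<lambda>x. a * rot \<beta> k f x + b * rot \<beta> k g x)"
  by (simp add: rot_def pauliX_lin algebra_simps)

lemma fold_rot_lin:
  "fold (rot \<beta>) ks (\<lambda>x. a * f x + b * g x) =
     (\<lambda>x. a * fold (rot \<beta>) ks f x + b * fold (rot \<beta>) ks g x)"
  by (induction ks arbitrary: f g) (simp_all add: rot_lin)

text \<open>
  Splitting \<open>\<psi>\<close> into the two eigenvectors of \<open>X\<^sub>k\<close> turns the operator \<open>X\<^sub>k\<close> in the exponent
  into a shift of \<open>\<mu>\<close> by \<open>\<plusminus>1\<close>; no product of operator series is needed.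
\<close>

lemma exp_shifted_mixer_sums:
  assumes "distinct ks"
  shows "(\<lambda>n. (\<i> * complex_of_real \<beta>) ^ n / fact n * (shifted_mixer \<mu> (set ks) ^^ n) \<psi> x)
           sums (exp (\<i> * complex_of_real \<beta> * \<mu>) * fold (rot \<beta>) ks \<psi> x)"
  using assms
proof (induction ks arbitrary: \<mu> \<psi>)
  case Nil
  have pow: "(shifted_mixer \<mu> {} ^^ n) \<psi> = (\<lambda>x. \<mu> ^ n * \<psi> x)" for n
    by (induction n) (simp_all add: shifted_mixer_def mixer_def mult.assoc)
  have "(\<lambda>n. (\<i> * complex_of_real \<beta> * \<mu>) ^ n /\<^sub>R fact n * \<psi> x)
          sums (exp (\<i> * complex_of_real \<beta> * \<mu>) * \<psi> x)"
    by (intro sums_mult2 exp_converges)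
  then show ?case
    by (simp add: pow power_mult_distrib scaleR_conv_of_real field_simps)
next
  case (Cons k ks)
  let ?c = "\<i> * complex_of_real \<beta>"
  let ?f = "\<lambda>x. 1 * \<psi> x + 1 * pauliX k \<psi> x"
  let ?g = "\<lambda>x. 1 * \<psi> x + (-1) * pauliX k \<psi> x"
  let ?F = "fold (rot \<beta>) ks"
  have k: "k \<notin> set ks" "distinct ks" using Cons.prems by auto
  have f: "pauliX k ?f = (\<lambda>x. 1 * ?f x)"
    unfolding pauliX_lin pauliX_pauliX by (simp add: add.commute)
  have g: "pauliX k ?g = (\<lambda>x. (-1) * ?g x)"
    unfolding pauliX_lin pauliX_pauliX by (simp add: add.commute)
  have "\<psi> = (\<lambda>x. 1/2 * ?f x + 1/2 * ?g x)"
    by (simp add: fun_eq_iff field_simps)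
  then have pow: "(shifted_mixer \<mu> (insert k (set ks)) ^^ n) \<psi> x =
      1/2 * (shifted_mixer (\<mu> + 1) (set ks) ^^ n) ?f x +
      1/2 * (shifted_mixer (\<mu> + (-1)) (set ks) ^^ n) ?g x" for n
    using shifted_mixer_pow_lin[of n \<mu> "insert k (set ks)" "1/2" ?f "1/2" ?g]
      shifted_mixer_pow_eigen[OF finite_set k(1) f, of n \<mu>]
      shifted_mixer_pow_eigen[OF finite_set k(1) g, of n \<mu>]
    by metis
  have "(\<lambda>n. 1/2 * (?c ^ n / fact n * (shifted_mixer (\<mu> + 1) (set ks) ^^ n) ?f x) +
             1/2 * (?c ^ n / fact n * (shifted_mixer (\<mu> + (-1)) (set ks) ^^ n) ?g x))
          sums (1/2 * (exp (?c * (\<mu> + 1)) * ?F ?f x) + 1/2 * (exp (?c * (\<mu> + (-1))) * ?F ?g x))"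
    by (intro sums_add sums_mult Cons.IH k)
  also have "(\<lambda>n. 1/2 * (?c ^ n / fact n * (shifted_mixer (\<mu> + 1) (set ks) ^^ n) ?f x) +
             1/2 * (?c ^ n / fact n * (shifted_mixer (\<mu> + (-1)) (set ks) ^^ n) ?g x)) =
      (\<lambda>n. ?c ^ n / fact n * (shifted_mixer \<mu> (set (k # ks)) ^^ n) \<psi> x)"
    unfolding list.set pow distrib_left mult.left_commute[of "1/2"] ..
  also have "1/2 * (exp (?c * (\<mu> + 1)) * ?F ?f x) + 1/2 * (exp (?c * (\<mu> + (-1))) * ?F ?g x)
      = exp (?c * \<mu>) * (exp ?c / 2 * ?F ?f x + exp (- ?c) / 2 * ?F ?g x)"
  proof -
    have "exp (c * (\<mu> + 1)) = exp (c * \<mu>) * exp c" "exp (c * (\<mu> + (-1))) = exp (c * \<mu>) * exp (- c)"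
      for c by (simp_all add: exp_add[symmetric] algebra_simps)
    then have "1/2 * (exp (c * (\<mu> + 1)) * a) + 1/2 * (exp (c * (\<mu> + (-1))) * b) =
        exp (c * \<mu>) * (exp c / 2 * a + exp (- c) / 2 * b)" for a b c
      by (simp only: distrib_left) (simp add: mult.assoc)
    then show ?thesis .
  qed
  also have "exp ?c / 2 * ?F ?f x + exp (- ?c) / 2 * ?F ?g x =
      ?F (\<lambda>x. exp ?c / 2 * ?f x + exp (- ?c) / 2 * ?g x) x"
    by (simp only: fold_rot_lin)
  \<comment> \<open>Euler's formula: the half sum of the exponentials multiplies
    \<open>\<psi>\<close>, the half difference multiplies \<open>pauliX k \<psi>\<close>.\<close>
  also have "(\<lambda>x. exp ?c / 2 * ?f x + exp (- ?c) / 2 * ?g x) = rot \<beta> k \<psi>"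
  proof -
    have e: "exp ?c = complex_of_real (cos \<beta>) + \<i> * complex_of_real (sin \<beta>)"
      "exp (- ?c) = complex_of_real (cos \<beta>) - \<i> * complex_of_real (sin \<beta>)"
      using cis_conv_exp[of \<beta>] cis_conv_exp[of "-\<beta>"] by (auto simp: complex_eq_iff)
    show ?thesis
      unfolding e rot_def by (simp add: fun_eq_iff field_simps)
  qed
  finally show ?case by simp
qed

text \<open>The case \<open>\<mu> = 0\<close>. Any enumeration of the qubits is allowed, so the
  rotations of two chosen qubits can be made the outermost ones.\<close>

lemma op_exp_mixer:
  assumes "distinct ks"
  shows "op_exp (\<i> * complex_of_real \<beta>) (mixer (set ks)) \<psi> = fold (rot \<beta>) ks \<psi>"
proof
  fix x
  have "shifted_mixer 0 (set ks) = mixer (set ks)"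
    by (intro ext) (simp add: shifted_mixer_def)
  then show "op_exp (\<i> * complex_of_real \<beta>) (mixer (set ks)) \<psi> x = fold (rot \<beta>) ks \<psi> x"
    using exp_shifted_mixer_sums[OF assms, of \<beta> 0 \<psi> x]
    by (simp add: op_exp_def sums_iff)
qed

text \<open>The eigenvalue of the Hamiltonian at the basis state \<open>x\<close>; in contrast to
  \<open>cost\<close>, the offset is left out.\<close>

definition energy :: "ising \<Rightarrow> (nat \<Rightarrow> real) \<Rightarrow> real" where
  "energy I x = (\<Sum>e\<in>edges I. weight I e * (\<Prod>v\<in>e. x v))"

lemma op_exp_hamiltonian:
  "op_exp c (hamiltonian I) \<psi> = (\<lambda>x. exp (c * complex_of_real (energy I x)) * \<psi> x)"
proof
  fix x
  have H: "hamiltonian I \<phi> = (\<lambda>x. complex_of_real (energy I x) * \<phi> x)" for \<phi>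
    by (simp add: hamiltonian_def Z_prod_def energy_def sum_distrib_right mult.assoc)
  have pow: "(hamiltonian I ^^ n) \<psi> = (\<lambda>x. complex_of_real (energy I x) ^ n * \<psi> x)" for n
    by (induction n) (simp_all add: H mult.assoc)
  have "(\<lambda>n. (c * complex_of_real (energy I x)) ^ n /\<^sub>R fact n * \<psi> x)
          sums (exp (c * complex_of_real (energy I x)) * \<psi> x)"
    by (intro sums_mult2 exp_converges)
  then show "op_exp c (hamiltonian I) \<psi> x = exp (c * complex_of_real (energy I x)) * \<psi> x"
    by (simp add: op_exp_def pow power_mult_distrib scaleR_conv_of_real field_simps sums_iff)
qed

section \<open>Inner products and the Heisenberg picture of the mixer\<close>

definition braket :: "nat set \<Rightarrow> state \<Rightarrow> state \<Rightarrow> complex" where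
  "braket V \<psi> \<phi> = (\<Sum>x\<in>spins V. cnj (\<psi> x) * \<phi> x)"

lemma finite_spins: "finite V \<Longrightarrow> finite (spins V)"
  by (simp add: spins_def finite_PiE)

lemma card_spins: "finite V \<Longrightarrow> card (spins V) = 2 ^ card V"
  by (simp add: spins_def card_PiE numeral_2_eq_2)

lemma spins_flip: "x \<in> spins V \<Longrightarrow> k \<in> V \<Longrightarrow> x(k := - x k) \<in> spins V"
  by (auto simp: spins_def PiE_iff extensional_def)

lemma sum_spins_flip: "k \<in> V \<Longrightarrow> (\<Sum>x\<in>spins V. f (x(k := - x k))) = (\<Sum>x\<in>spins V. f x)"
  by (rule sum.reindex_bij_witness[where i = "\<lambda>x. x(k := - x k)" and j = "\<lambda>x. x(k := - x k)"])
     (auto simp: spins_flip)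

lemma braket_pauliX: "k \<in> V \<Longrightarrow> braket V (pauliX k \<psi>) \<phi> = braket V \<psi> (pauliX k \<phi>)"
  using sum_spins_flip[of k V "\<lambda>x. cnj (pauliX k \<psi> x) * \<phi> x"]
  by (simp add: braket_def pauliX_def)

lemma braket_rot: 
  assumes "k \<in> V" shows "braket V (rot \<beta> k \<psi>) \<phi> = braket V \<psi> (rot (- \<beta>) k \<phi>)"
proof -
  have "braket V (rot \<beta> k \<psi>) \<phi> =
      complex_of_real (cos \<beta>) * braket V \<psi> \<phi> - \<i> * complex_of_real (sin \<beta>) * braket V (pauliX k \<psi>) \<phi>"
    by (simp add: braket_def rot_def sum_distrib_left algebra_simps sum_subtractf sum.distrib sum_negf)
  also have "\<dots> = braket V \<psi> (rot (- \<beta>) k \<phi>)"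
    unfolding braket_pauliX[OF assms]
    by (simp add: braket_def rot_def sum_distrib_left algebra_simps sum_subtractf sum.distrib sum_negf)
  finally show ?thesis .
qed

lemma pauliX_rot: "pauliX l (rot \<beta> k \<psi>) = rot \<beta> k (pauliX l \<psi>)"
  unfolding rot_def pauliX_lin pauliX_commute[of k l] ..

lemma rot_commute: "rot \<alpha> k (rot \<beta> l \<psi>) = rot \<beta> l (rot \<alpha> k \<psi>)"
  unfolding rot_def[of \<alpha> k] pauliX_rot rot_lin ..

lemma rot_rot: "rot \<alpha> k (rot \<beta> k \<psi>) = rot (\<alpha> + \<beta>) k \<psi>"
  unfolding rot_def pauliX_lin pauliX_pauliX
  by (simp add: fun_eq_iff cos_add sin_add algebra_simps)

lemma rot_0 [simp]: "rot 0 k \<psi> = \<psi>"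
  by (simp add: rot_def)

lemma rot_pauliZ: "k \<noteq> l \<Longrightarrow> rot \<beta> k (pauliZ l \<psi>) = pauliZ l (rot \<beta> k \<psi>)"
  by (simp add: rot_def pauliZ_def pauliX_def algebra_simps)

text \<open>\<open>pauliX k\<close> and \<open>pauliZ k\<close> anticommute, so the sine term
  changes sign.\<close>

lemma rot_pauliZ_same: "rot \<beta> k (pauliZ k \<psi>) = pauliZ k (rot (- \<beta>) k \<psi>)"
  by (simp add: rot_def pauliZ_def pauliX_def algebra_simps)

lemma braket_fold_rot:
  assumes "set ks \<subseteq> V" and "\<And>k \<psi>. k \<in> set ks \<Longrightarrow> rot \<beta> k (A \<psi>) = A (rot \<beta> k \<psi>)"
  shows "braket V (fold (rot \<beta>) ks \<psi>) (A (fold (rot \<beta>) ks \<psi>)) = braket V \<psi> (A \<psi>)"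
  using assms
proof (induction ks arbitrary: \<psi>)
  case (Cons k ks)
  have "braket V (rot \<beta> k \<psi>) (A (rot \<beta> k \<psi>)) = braket V \<psi> (rot (-\<beta>) k (rot \<beta> k (A \<psi>)))"
    using Cons.prems(1) Cons.prems(2)[of k] by (simp add: braket_rot)
  then have "braket V (rot \<beta> k \<psi>) (A (rot \<beta> k \<psi>)) = braket V \<psi> (A \<psi>)"
    by (simp add: rot_rot)
  then show ?case
    using Cons by simp
qed simp

text \<open>Rotations of the other qubits commute with the observable and cancel against their
  adjoints. Those of \<open>i\<close> and \<open>j\<close> are reversed on their way through
  \<open>Z\<^sub>i Z\<^sub>j\<close> and add up instead, hence the angle
  \<open>2 * \<beta>\<close>.\<close>

lemma braket_ZZ_mixer:
  assumes "finite V" "i \<in> V" "j \<in> V" "i \<noteq> j"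
    and \<psi>_def: "\<psi> = op_exp (\<i> * complex_of_real \<beta>) (mixer V) \<phi>"
  shows "braket V \<psi> (pauliZ i (pauliZ j \<psi>)) =
    braket V \<phi> (pauliZ i (pauliZ j (rot (2 * \<beta>) i (rot (2 * \<beta>) j \<phi>))))"
proof -
  obtain ks where ks: "set ks = V - {i, j}" "distinct ks"
    using finite_distinct_list[of "V - {i, j}"] assms(1) by blast
  have V: "V = set (ks @ [i, j])" "distinct (ks @ [i, j])"
    using ks assms by auto
  let ?\<chi> = "fold (rot \<beta>) ks \<phi>"
  let ?A = "\<lambda>f. pauliZ i (pauliZ j (rot (2 * \<beta>) i (rot (2 * \<beta>) j f)))"
  have \<psi>: "\<psi> = rot \<beta> j (rot \<beta> i ?\<chi>)"
    unfolding \<psi>_def V(1) op_exp_mixer[OF V(2)] by simp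
  have "braket V \<psi> (pauliZ i (pauliZ j \<psi>)) =
      braket V ?\<chi> (rot (-\<beta>) i (rot (-\<beta>) j (pauliZ i (pauliZ j \<psi>))))"
    unfolding \<psi> using assms by (simp add: braket_rot)
  also have "rot (-\<beta>) i (rot (-\<beta>) j (pauliZ i (pauliZ j \<psi>))) = ?A ?\<chi>"
  proof -
    have "rot (-\<beta>) i (rot (-\<beta>) j (pauliZ i (pauliZ j \<psi>))) =
        pauliZ i (pauliZ j (rot \<beta> i (rot \<beta> j (rot \<beta> i (rot \<beta> j ?\<chi>)))))"
      using assms(4) by (simp add: \<psi> rot_pauliZ rot_pauliZ_same rot_commute[of \<beta> j \<beta> i])
    also have "rot \<beta> i (rot \<beta> j (rot \<beta> i (rot \<beta> j ?\<chi>))) = rot (2*\<beta>) i (rot (2*\<beta>) j ?\<chi>)"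
      by (simp only: rot_commute[of \<beta> j \<beta> i] rot_rot mult_2)
    finally show ?thesis .
  qed
  also have "braket V ?\<chi> (?A ?\<chi>) = braket V \<phi> (?A \<phi>)"
  proof (rule braket_fold_rot)
    show "set ks \<subseteq> V" using ks by auto
    fix k f assume "k \<in> set ks"
    then have "k \<noteq> i" "k \<noteq> j" using ks by auto
    then show "rot \<beta> k (?A f) = ?A (rot \<beta> k f)"
      by (simp add: rot_pauliZ rot_commute[of \<beta> k])
  qed
  finally show ?thesis .
qed

section \<open>The correlation of two spins\<close>

lemma spins_cases: "x \<in> spins V \<Longrightarrow> v \<in> V \<Longrightarrow> x v = 1 \<or> x v = -1"
  by (auto simp: spins_def PiE_iff)

lemma spins_sq: "x \<in> spins V \<Longrightarrow> v \<in> V \<Longrightarrow> x v * x v = 1"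
  using spins_cases by fastforce

text \<open>For \<open>a \<noteq> b\<close>, flipping the spin \<open>a\<close> negates the summand,
  so the sum equals its own negative; for \<open>a = b\<close> every summand is 1.\<close>

lemma sum_spins_monomial:
  assumes "finite V" "a \<in> V" "b \<in> V"
  shows "(\<Sum>x\<in>spins V. complex_of_real (x a * x b)) = (if a = b then 2 ^ card V else 0)"
proof (cases "a = b")
  case True
  then have "(\<Sum>x\<in>spins V. complex_of_real (x a * x b)) = (\<Sum>x\<in>spins V. 1)"
    using assms by (intro sum.cong) (auto simp: spins_sq)
  then show ?thesis
    using True assms(1) by (simp add: card_spins)
next
  case False
  then show ?thesis
    using sum_spins_flip[OF assms(2), of "\<lambda>x. complex_of_real (x a * x b)"]
    by (auto simp: sum_negf equal_neg_zero)
qed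

text \<open>A sign drops out of the even cosine and factors out of the odd sine, which makes the
  phase affine in \<open>t\<close>.\<close>

lemma exp_sign:
  assumes "t = 1 \<or> t = -1"
  shows "exp (\<i> * complex_of_real (- (2 * \<gamma> * t))) =
    complex_of_real (cos (2 * \<gamma>)) - \<i> * complex_of_real (t * sin (2 * \<gamma>))"
  using assms cis_conv_exp[of "- (2 * \<gamma> * t)"] by (auto simp: complex_eq_iff)

lemma exp_sign2:
  assumes "s = 1 \<or> s = -1" "t = 1 \<or> t = -1"
  shows "exp (\<i> * complex_of_real (- (2 * \<gamma> * (s + t)))) =
    (complex_of_real (cos (2 * \<gamma>)) - \<i> * complex_of_real (s * sin (2 * \<gamma>))) *
    (complex_of_real (cos (2 * \<gamma>)) - \<i> * complex_of_real (t * sin (2 * \<gamma>)))"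
  unfolding exp_sign[OF assms(1), symmetric] exp_sign[OF assms(2), symmetric] exp_add[symmetric]
  by (simp add: algebra_simps)

text \<open>Here \<open>t\<close>, \<open>u\<close>, \<open>v\<close> stand for
  \<open>x i * x j\<close>, \<open>x i * x p\<close>, \<open>x j * x q\<close>. Sorting by monomials
  prepares the sum over all spins.\<close>

lemma correlation_expand:
  fixes A C S W1 W2 W3 c s t u v :: complex
  assumes "t * t = 1"
  shows "t * (C^2 * A + \<i> * C * S * (A * ((c - \<i> * W1 * s * t) * (c - \<i> * W2 * s * u)))
      + \<i> * C * S * (A * ((c - \<i> * W1 * s * t) * (c - \<i> * W3 * s * v)))
      - S^2 * (A * ((c - \<i> * W2 * s * u) * (c - \<i> * W3 * s * v)))) =
    A * (C^2 + 2 * \<i> * C * S * c^2 - S^2 * c^2) * t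
      + A * (2 * C * S * W1 * s * c)
      + A * (C * S * W2 * s * c + \<i> * S^2 * W2 * s * c) * (t * u)
      + A * (C * S * W3 * s * c + \<i> * S^2 * W3 * s * c) * (t * v)
      - A * (\<i> * C * S * W1 * W2 * s^2) * u
      - A * (\<i> * C * S * W1 * W3 * s^2) * v
      + A * (S^2 * W2 * W3 * s^2) * (t * (u * v))"
proof -
  have sq: "t * (t * z) = z" "\<i> * (\<i> * z) = - z" for z
    using assms by (simp_all add: mult.assoc[symmetric])
  show ?thesis
    by (simp add: power2_eq_square algebra_simps assms sq)
qed

text \<open>\<open>H\<close> is split into the three terms containing the spin \<open>i\<close> or
  \<open>j\<close> and a rest \<open>r\<close>. The operator flips only these two spins, so
  \<open>r\<close> cancels from all phase differences. Single flips yield the term with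
  \<open>w1\<close>, the double flip the term with \<open>w2 * w3\<close>.\<close>

lemma braket_phase_state:
  fixes H r :: "(nat \<Rightarrow> real) \<Rightarrow> real" and w1 w2 w3 \<beta> \<gamma> a :: real
  assumes V: "finite V" "i \<in> V" "j \<in> V" "p \<in> V" "q \<in> V"
    and ne: "i \<noteq> j" "p \<notin> {i, j}" "q \<notin> {i, j}"
    and H: "\<And>x. H x = r x + w1 * (x i * x j) + w2 * (x i * x p) + w3 * (x j * x q)"
    and r: "\<And>x t. r (x(i := t)) = r x" "\<And>x t. r (x(j := t)) = r x"
    and w: "w1 = 1 \<or> w1 = -1" "w2 = 1 \<or> w2 = -1" "w3 = 1 \<or> w3 = -1"
    and a: "a * a * 2 ^ card V = 1"
    and \<phi>: "\<And>x. x \<in> spins V \<Longrightarrow> \<phi> x = exp (\<i> * complex_of_real (\<gamma> * H x)) * complex_of_real a"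
  shows "braket V \<phi> (pauliZ i (pauliZ j (rot (2 * \<beta>) i (rot (2 * \<beta>) j \<phi>)))) =
    complex_of_real (w1 * (2 * (sin (2*\<beta>) * sin (2*\<gamma>)) * (cos (2*\<beta>) * cos (2*\<gamma>)))
     + (if p = q then w2 * w3 * (sin (2*\<beta>) * sin (2*\<gamma>))\<^sup>2 else 0))"
proof -
  define A where "A = complex_of_real (a * a)"
  define C where "C = complex_of_real (cos (2*\<beta>))"
  define S where "S = complex_of_real (sin (2*\<beta>))"
  define c where "c = complex_of_real (cos (2*\<gamma>))"
  define s where "s = complex_of_real (sin (2*\<gamma>))"
  define W1 W2 W3 where "W1 = complex_of_real w1" and "W2 = complex_of_real w2"
    and "W3 = complex_of_real w3"
  define m where "m u v x = complex_of_real (x u * x v)" for u v :: nat and x :: "nat \<Rightarrow> real"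
  have sgn: "u * (x k * x l) = 1 \<or> u * (x k * x l) = -1"
    if "x \<in> spins V" "k \<in> V" "l \<in> V" "u = 1 \<or> u = -1" for x k l and u :: real
    using spins_cases[OF that(1,2)] spins_cases[OF that(1,3)] that(4) by auto
  have phase: "cnj (exp (\<i> * complex_of_real u)) * exp (\<i> * complex_of_real v) =
      exp (\<i> * complex_of_real (v - u))" for u v
    by (simp only: cis_conv_exp[symmetric] cis_cnj cis_mult) simp
  have quot: "cnj (\<phi> x) * \<phi> y = A * exp (\<i> * complex_of_real (\<gamma> * (H y - H x)))"
    if "x \<in> spins V" "y \<in> spins V" for x y
    using phase[of "\<gamma> * H x" "\<gamma> * H y"] \<phi>[OF that(1)] \<phi>[OF that(2)]
    by (simp add: A_def right_diff_distrib mult_ac)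
  have rotx: "rot (2 * \<beta>) k f x = C * f x + \<i> * S * f (x(k := - x k))" for k f x
    by (simp add: rot_def pauliX_def C_def S_def)
  have point: "cnj (\<phi> x) * pauliZ i (pauliZ j (rot (2 * \<beta>) i (rot (2 * \<beta>) j \<phi>))) x =
      A * (C^2 + 2 * \<i> * C * S * c^2 - S^2 * c^2) * m i j x
      + A * (2 * C * S * W1 * s * c)
      + A * (C * S * W2 * s * c + \<i> * S^2 * W2 * s * c) * m j p x
      + A * (C * S * W3 * s * c + \<i> * S^2 * W3 * s * c) * m i q x
      - A * (\<i> * C * S * W1 * W2 * s^2) * m i p x
      - A * (\<i> * C * S * W1 * W3 * s^2) * m j q x
      + A * (S^2 * W2 * W3 * s^2) * m p q x" if x: "x \<in> spins V" for x
  proof -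
    let ?xi = "x(i := - x i)" and ?xj = "x(j := - x j)" and ?xij = "x(i := - x i, j := - x j)"
    have fl: "?xi \<in> spins V" "?xj \<in> spins V" "?xij \<in> spins V"
      using spins_flip[OF x V(2)] spins_flip[OF x V(3)] spins_flip[OF spins_flip[OF x V(2)] V(3)] ne
      by auto
    \<comment> \<open>A term containing exactly one flipped spin changes sign; under the double flip
      \<open>x i * x j\<close> is unchanged, so \<open>w1\<close> disappears.\<close>
    have d: "\<gamma> * (H ?xi - H x) = - (2 * \<gamma> * (w1 * (x i * x j) + w2 * (x i * x p)))"
      "\<gamma> * (H ?xj - H x) = - (2 * \<gamma> * (w1 * (x i * x j) + w3 * (x j * x q)))"
      "\<gamma> * (H ?xij - H x) = - (2 * \<gamma> * (w2 * (x i * x p) + w3 * (x j * x q)))"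
      using ne by (auto simp: H r algebra_simps)
    have sg: "w1 * (x i * x j) = 1 \<or> w1 * (x i * x j) = -1"
      "w2 * (x i * x p) = 1 \<or> w2 * (x i * x p) = -1"
      "w3 * (x j * x q) = 1 \<or> w3 * (x j * x q) = -1"
      using sgn[OF x] V w by auto
    have fq: "cnj (\<phi> x) * \<phi> x = A"
      "cnj (\<phi> x) * \<phi> ?xi = A * ((c - \<i> * W1 * s * m i j x) * (c - \<i> * W2 * s * m i p x))"
      "cnj (\<phi> x) * \<phi> ?xj = A * ((c - \<i> * W1 * s * m i j x) * (c - \<i> * W3 * s * m j q x))"
      "cnj (\<phi> x) * \<phi> ?xij = A * ((c - \<i> * W2 * s * m i p x) * (c - \<i> * W3 * s * m j q x))"
      unfolding quot[OF x x] quot[OF x fl(1)] quot[OF x fl(2)] quot[OF x fl(3)] d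
        exp_sign2[OF sg(1,2)] exp_sign2[OF sg(1,3)] exp_sign2[OF sg(2,3)]
      by (simp_all add: c_def s_def W1_def W2_def W3_def m_def mult_ac)
    have mm: "m i j x * m i j x = 1" "m i j x * m i p x = m j p x" "m i j x * m j q x = m i q x"
      "m i j x * (m i p x * m j q x) = m p q x"
      using spins_cases[OF x V(2)] spins_cases[OF x V(3)] by (auto simp: m_def)
    have "cnj (\<phi> x) * pauliZ i (pauliZ j (rot (2 * \<beta>) i (rot (2 * \<beta>) j \<phi>))) x =
        m i j x * (C^2 * (cnj (\<phi> x) * \<phi> x) + \<i> * C * S * (cnj (\<phi> x) * \<phi> ?xi)
          + \<i> * C * S * (cnj (\<phi> x) * \<phi> ?xj) - S^2 * (cnj (\<phi> x) * \<phi> ?xij))"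
      unfolding pauliZ_def rotx m_def using ne(1)
      by (simp add: power2_eq_square left_diff_distrib right_diff_distrib
          distrib_left distrib_right mult_ac)
    then show ?thesis
      unfolding fq correlation_expand[OF mm(1)] mm(2-4) .
  qed
  have msum: "(\<Sum>x\<in>spins V. B * m u v x) = (if u = v then B * 2 ^ card V else 0)"
    if "u \<in> V" "v \<in> V" for B u v
    using sum_spins_monomial[OF V(1) that] by (simp add: m_def sum_distrib_left[symmetric])
  have A: "A * 2 ^ card V = 1"
    using arg_cong[OF a, of complex_of_real] by (simp add: A_def)
  have "braket V \<phi> (pauliZ i (pauliZ j (rot (2 * \<beta>) i (rot (2 * \<beta>) j \<phi>)))) = (\<Sum>x\<in>spins V.
      A * (C^2 + 2 * \<i> * C * S * c^2 - S^2 * c^2) * m i j x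
      + A * (2 * C * S * W1 * s * c)
      + A * (C * S * W2 * s * c + \<i> * S^2 * W2 * s * c) * m j p x
      + A * (C * S * W3 * s * c + \<i> * S^2 * W3 * s * c) * m i q x
      - A * (\<i> * C * S * W1 * W2 * s^2) * m i p x
      - A * (\<i> * C * S * W1 * W3 * s^2) * m j q x
      + A * (S^2 * W2 * W3 * s^2) * m p q x)"
    unfolding braket_def by (intro sum.cong refl point)
  \<comment> \<open>Only the constant term and monomials in two equal spins survive the summation;
    the latter can only be \<open>m p q\<close>, for \<open>p = q\<close>.\<close>
  also have "\<dots> = A * (2 * C * S * W1 * s * c) * 2 ^ card V
      + (if p = q then A * (S^2 * W2 * W3 * s^2) * 2 ^ card V else 0)"
    unfolding sum.distrib sum_subtractf using V ne
    by (simp only: msum) (simp add: card_spins)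
  also have "\<dots> = (A * 2 ^ card V) * (2 * C * S * W1 * s * c
      + (if p = q then S^2 * W2 * W3 * s^2 else 0))"
    by (simp add: algebra_simps)
  finally show ?thesis
    by (simp add: A C_def S_def c_def s_def W1_def W2_def W3_def power_mult_distrib)
qed

section \<open>Cycles as lists\<close>

fun path_edges :: "nat list \<Rightarrow> nat set set" where
  "path_edges (a # b # xs) = insert {a, b} (path_edges (b # xs))"
| "path_edges _ = {}"

text \<open>Edges are unordered, so all rotations and the reversal of a list describe the same
  cycle. This freedom brings a chosen edge to the end.\<close>

definition cycle_edges :: "nat list \<Rightarrow> nat set set" where
  "cycle_edges vs = insert {last vs, hd vs} (path_edges vs)"

lemma path_edges_Cons: "xs \<noteq> [] \<Longrightarrow> path_edges (a # xs) = insert {a, hd xs} (path_edges xs)"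
  by (cases xs) auto

lemma path_edges_append:
  "xs \<noteq> [] \<Longrightarrow> ys \<noteq> [] \<Longrightarrow>
     path_edges (xs @ ys) = insert {last xs, hd ys} (path_edges xs \<union> path_edges ys)"
proof (induction xs)
  case (Cons a xs)
  then show ?case by (cases "xs = []") (auto simp: path_edges_Cons)
qed simp

lemma path_edges_rev [simp]: "path_edges (rev xs) = path_edges xs"
proof (induction xs)
  case (Cons a xs)
  then show ?case
    by (cases "xs = []") (auto simp: path_edges_append path_edges_Cons last_rev insert_commute)
qed simp

lemma path_edges_subset: "e \<in> path_edges xs \<Longrightarrow> e \<subseteq> set xs"
  by (induction xs rule: path_edges.induct) auto

lemma finite_path_edges [simp]: "finite (path_edges xs)"
  by (induction xs rule: path_edges.induct) auto

lemma path_edges_split: "e \<in> path_edges xs \<Longrightarrow> \<exists>ys a b zs. xs = ys @ a # b # zs \<and> e = {a, b}"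
proof (induction xs rule: path_edges.induct)
  case (1 a b xs)
  show ?case
  proof (cases "e = {a, b}")
    case True
    then show ?thesis by (intro exI[of _ "[]"]) auto
  next
    case False
    with 1 obtain ys c d zs where "b # xs = ys @ c # d # zs" "e = {c, d}" by auto
    then show ?thesis by (intro exI[of _ "a # ys"]) auto
  qed
qed auto

lemma cycle_edges_rotate: "cycle_edges (xs @ ys) = cycle_edges (ys @ xs)"
  by (cases "xs = []"; cases "ys = []") (auto simp: cycle_edges_def path_edges_append)

lemma cycle_edges_rev: "cycle_edges (rev xs) = cycle_edges xs"
  by (cases "xs = []") (auto simp: cycle_edges_def last_rev hd_rev insert_commute)

lemma cycle_edges_snoc2:
  "us \<noteq> [] \<Longrightarrow> cycle_edges (us @ [i, j]) = path_edges us \<union> {{i, j}, {i, last us}, {j, hd us}}"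
  by (auto simp: cycle_edges_def path_edges_append insert_commute)

lemma cycle_edges_snoc:
  "us \<noteq> [] \<Longrightarrow> cycle_edges (us @ [i]) = path_edges us \<union> {{i, last us}, {i, hd us}}"
  by (auto simp: cycle_edges_def path_edges_append insert_commute)

text \<open>Cut the cycle right behind the edge; for the closing edge, this moves the first vertex
  to the end. Equality of multisets transfers length, distinctness and the vertex set.\<close>

lemma cycle_edges_consecutive:
  assumes "e \<in> cycle_edges vs" "2 \<le> length vs"
  shows "\<exists>us a b. e = {a, b} \<and> cycle_edges vs = cycle_edges (us @ [a, b]) \<and> mset vs = mset (us @ [a, b])"
proof (cases "e \<in> path_edges vs")
  case True
  then obtain ys a b zs where *: "vs = ys @ a # b # zs" "e = {a, b}"
    using path_edges_split by blast
  have "cycle_edges vs = cycle_edges ((zs @ ys) @ [a, b])"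
    using cycle_edges_rotate[of "ys @ [a, b]" zs] * by simp
  moreover have "mset vs = mset ((zs @ ys) @ [a, b])"
    using *(1) by simp
  ultimately show ?thesis
    using *(2) by blast
next
  case False
  then have e: "e = {last vs, hd vs}"
    using assms by (simp add: cycle_edges_def)
  obtain h ms l where h: "vs = h # ms @ [l]"
    using assms(2) by (cases vs; cases "tl vs" rule: rev_cases) auto
  have "cycle_edges vs = cycle_edges (ms @ [l, h])"
    using cycle_edges_rotate[of "[h]" "ms @ [l]"] by (simp add: h)
  moreover have "mset vs = mset (ms @ [l, h])"
    by (simp add: h)
  moreover have "e = {l, h}"
    using e by (simp add: h)
  ultimately show ?thesis
    by blast
qed

text \<open>Reversing the cycle and rotating two vertices back exchanges the last two. Both orders
  matter because RQAOA may eliminate either endpoint.\<close>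

lemma cycle_edges_ending:
  assumes "{i, j} \<in> cycle_edges vs" "2 \<le> length vs"
  shows "\<exists>us. cycle_edges vs = cycle_edges (us @ [i, j]) \<and> mset vs = mset (us @ [i, j])"
proof -
  obtain us a b where *: "{i, j} = {a, b}" "cycle_edges vs = cycle_edges (us @ [a, b])"
    "mset vs = mset (us @ [a, b])"
    using cycle_edges_consecutive[OF assms] by blast
  have "cycle_edges (us @ [a, b]) = cycle_edges (rev us @ [b, a])"
    using cycle_edges_rev[of "us @ [a, b]"] cycle_edges_rotate[of "[b, a]" "rev us"] by simp
  moreover have "mset (us @ [a, b]) = mset (rev us @ [b, a])"
    by simp
  moreover have "i = a \<and> j = b \<or> i = b \<and> j = a"
    using *(1) by (simp add: doubleton_eq_iff)
  ultimately show ?thesis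
    using *(2,3) by metis
qed

section \<open>Level-1 QAOA on a ring\<close>

text \<open>The list records a cyclic order of arbitrary labels, since contraction leaves gaps in
  the numbering. On two vertices the closing edge would coincide with the path edge, hence the bound
  3.\<close>

definition ring :: "ising \<Rightarrow> nat list \<Rightarrow> bool" where
  "ring I vs \<longleftrightarrow> distinct vs \<and> 3 \<le> length vs \<and> verts I = set vs \<and> edges I = cycle_edges vs \<and>
     (\<forall>e\<in>edges I. weight I e \<in> {1, -1})"

lemma ring_ending:
  assumes "ring I vs" "{i, j} \<in> edges I"
  obtains us where "ring I (us @ [i, j])"
proof -
  obtain us where us: "cycle_edges vs = cycle_edges (us @ [i, j])" "mset vs = mset (us @ [i, j])"
    using cycle_edges_ending[of i j vs] assms unfolding ring_def by auto
  then have "ring I (us @ [i, j])"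
    using assms(1) mset_eq_setD[OF us(2)] mset_eq_length[OF us(2)] mset_eq_imp_distinct_iff[OF us(2)]
    unfolding ring_def by auto
  then show ?thesis by (rule that)
qed

lemma ring_edge:
  assumes "ring I vs" "e \<in> edges I"
  shows "\<exists>i j. i \<noteq> j \<and> e = {i, j}"
proof -
  obtain us a b where *: "e = {a, b}" "mset vs = mset (us @ [a, b])"
    using cycle_edges_consecutive[of e vs] assms unfolding ring_def by auto
  then show ?thesis
    using assms(1) mset_eq_imp_distinct_iff[OF *(2)] unfolding ring_def by auto
qed

lemma ring_weight: "ring I vs \<Longrightarrow> e \<in> edges I \<Longrightarrow> weight I e = 1 \<or> weight I e = -1"
  by (simp add: ring_def)

lemma ring_finite: "ring I vs \<Longrightarrow> finite (verts I) \<and> finite (edges I) \<and> edges I \<noteq> {}"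
  by (auto simp: ring_def cycle_edges_def)

text \<open>A normal form for one chosen edge: the other neighbour of \<open>i\<close> is the last
  vertex of \<open>us\<close>, that of \<open>j\<close> its first. They coincide exactly in a
  triangle.\<close>

locale ring_end =
  fixes I :: ising and us :: "nat list" and i j :: nat
  assumes ring: "ring I (us @ [i, j])"
begin

definition p where "p = last us"
definition q where "q = hd us"

lemma us: "us \<noteq> []"
  using ring by (auto simp: ring_def)

lemma distinct_ends: "i \<noteq> j" "p \<noteq> i" "p \<noteq> j" "q \<noteq> i" "q \<noteq> j"
  and p_in: "p \<in> set us" and q_in: "q \<in> set us" and ij_notin: "i \<notin> set us" "j \<notin> set us"
proof -
  show 1: "p \<in> set us" "q \<in> set us" using us by (auto simp: p_def q_def)
  show "i \<noteq> j" "i \<notin> set us" "j \<notin> set us" using ring by (auto simp: ring_def)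
  then show "p \<noteq> i" "p \<noteq> j" "q \<noteq> i" "q \<noteq> j" using 1 by auto
qed

lemma verts: "verts I = insert i (insert j (set us))"
  using ring by (auto simp: ring_def)

lemma edges: "edges I = path_edges us \<union> {{i, j}, {i, p}, {j, q}}"
  using ring us by (auto simp: ring_def cycle_edges_snoc2 p_def q_def)

lemma path_avoids: "e \<in> path_edges us \<Longrightarrow> i \<notin> e \<and> j \<notin> e"
  using path_edges_subset ij_notin by blast

lemma weights:
  "weight I {i, j} = 1 \<or> weight I {i, j} = -1" "weight I {i, p} = 1 \<or> weight I {i, p} = -1"
  "weight I {j, q} = 1 \<or> weight I {j, q} = -1"
  using ring edges by (auto simp: ring_def)

text \<open>The three edges at \<open>i\<close> or \<open>j\<close> are distinct even in a triangle,
  and none lies on the path.\<close>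

lemma sum_edges:
  fixes f :: "nat set \<Rightarrow> real"
  shows "sum f (edges I) = sum f (path_edges us) + f {i, j} + f {i, p} + f {j, q}"
proof -
  have "{j, q} \<notin> path_edges us" "{i, p} \<notin> insert {j, q} (path_edges us)"
    "{i, j} \<notin> insert {i, p} (insert {j, q} (path_edges us))"
    using path_avoids distinct_ends by (auto simp: doubleton_eq_iff)
  moreover have "edges I = insert {i, j} (insert {i, p} (insert {j, q} (path_edges us)))"
    using edges by auto
  ultimately show ?thesis by (simp add: algebra_simps)
qed

lemma card_verts: "card (verts I) = length us + 2"
  using ring distinct_card[of "us @ [i, j]"] by (simp add: ring_def)

lemma p_eq_q_iff: "p = q \<longleftrightarrow> card (verts I) = 3"
proof -
  obtain a as where a: "us = a # as" using us by (cases us) auto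
  have "p = q \<longleftrightarrow> as = []"
  proof -
    have "q = a" "p = (if as = [] then a else last as)"
      unfolding p_def q_def unfolding a by simp_all
    moreover have "a \<notin> set as"
      using ring unfolding ring_def a by simp
    ultimately show ?thesis
      using last_in_set[of as] by metis
  qed
  then show ?thesis using a by (auto simp: card_verts)
qed

lemma triangle: "p = q \<Longrightarrow> (\<Prod>e\<in>edges I. weight I e) = weight I {i, j} * weight I {i, p} * weight I {j, q}"
proof -
  assume pq: "p = q"
  then have "length us = 1" using p_eq_q_iff card_verts by simp
  then have "path_edges us = {}" by (cases us) auto
  then have "edges I = {{i, j}, {i, p}, {j, q}}" using edges by simp
  moreover have "{i, j} \<noteq> {i, p}" "{i, j} \<noteq> {j, q}" "{i, p} \<noteq> {j, q}"
    using distinct_ends by (auto simp: doubleton_eq_iff)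
  ultimately show ?thesis by simp
qed

end

text \<open>The frustration of a triangle with couplings \<plusminus>1: the product is 1 if some
  assignment satisfies all three couplings, and -1 otherwise. In longer rings
  \<open>p \<noteq> q\<close>, and no such product enters the correlation.\<close>

definition triangle_sign :: "ising \<Rightarrow> real" where
  "triangle_sign I = (if card (verts I) = 3 then \<Prod>e\<in>edges I. weight I e else 0)"

text \<open>The expected value of each single term \<open>J\<^sub>e Z\<^sub>i Z\<^sub>j\<close> of a
  ring, the same for all edges because couplings square to 1.\<close>

definition edge_gain :: "real \<Rightarrow> real \<Rightarrow> real \<Rightarrow> real" where
  "edge_gain \<kappa> \<beta> \<gamma> = 2 * (sin (2*\<beta>) * sin (2*\<gamma>)) * (cos (2*\<beta>) * cos (2*\<gamma>))
     + \<kappa> * (sin (2*\<beta>) * sin (2*\<gamma>))\<^sup>2"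

context ring_end
begin

lemma correlation:
  "correlation I \<beta> \<gamma> i j = weight I {i, j} * edge_gain (triangle_sign I) \<beta> \<gamma>"
proof -
  define r where "r x = (\<Sum>e\<in>path_edges us. weight I e * (\<Prod>v\<in>e. x v))" for x
  define \<phi> where "\<phi> = op_exp (\<i> * complex_of_real \<gamma>) (hamiltonian I) (plus_state (verts I))"
  let ?V = "verts I"
  have fin: "finite ?V" using verts by simp
  have r: "r (x(k := t)) = r x" if "k = i \<or> k = j" for x k t
    unfolding r_def
  proof (rule sum.cong)
    fix e assume "e \<in> path_edges us"
    then have "k \<notin> e" using path_avoids that by auto
    then have "(\<Prod>v\<in>e. (x(k := t)) v) = (\<Prod>v\<in>e. x v)"
      by (intro prod.cong) auto
    then show "weight I e * (\<Prod>v\<in>e. (x(k := t)) v) = weight I e * (\<Prod>v\<in>e. x v)" by simp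
  qed simp
  have "correlation I \<beta> \<gamma> i j = Re (braket ?V \<phi> (pauliZ i (pauliZ j (rot (2 * \<beta>) i (rot (2 * \<beta>) j \<phi>)))))"
    using braket_ZZ_mixer[of ?V i j _ \<beta> \<phi>] fin verts distinct_ends
    by (simp add: correlation_def expect_def braket_def qaoa_state_def \<phi>_def)
  also have "braket ?V \<phi> (pauliZ i (pauliZ j (rot (2 * \<beta>) i (rot (2 * \<beta>) j \<phi>)))) =
     complex_of_real (weight I {i, j} * (2 * (sin (2*\<beta>) * sin (2*\<gamma>)) * (cos (2*\<beta>) * cos (2*\<gamma>)))
     + (if p = q then weight I {i, p} * weight I {j, q} * (sin (2*\<beta>) * sin (2*\<gamma>))\<^sup>2 else 0))"
  proof (rule braket_phase_state[where H = "energy I" and r = r and a = "(1 / sqrt 2) ^ card ?V"])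
    show "energy I x = r x + weight I {i, j} * (x i * x j) + weight I {i, p} * (x i * x p)
        + weight I {j, q} * (x j * x q)" for x
      using distinct_ends by (simp add: energy_def sum_edges r_def)
    show "(1 / sqrt 2) ^ card ?V * (1 / sqrt 2) ^ card ?V * 2 ^ card ?V = 1"
      by (simp add: power_mult_distrib[symmetric])
    show "\<phi> x = exp (\<i> * complex_of_real (\<gamma> * energy I x)) * complex_of_real ((1 / sqrt 2) ^ card ?V)"
      if "x \<in> spins ?V" for x
      using that by (simp add: \<phi>_def op_exp_hamiltonian plus_state_def mult.assoc)
  qed (use fin verts distinct_ends p_in q_in weights r in auto)
  \<comment> \<open>For \<open>p = q\<close>, the product of the other two couplings equals
    \<open>weight I {i, j}\<close> times the product of all three.\<close>
  finally show ?thesis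
    using weights(1) triangle p_eq_q_iff
    by (auto simp: edge_gain_def triangle_sign_def algebra_simps)
qed

end

lemma ring_correlation:
  assumes "ring I vs" "{i, j} \<in> edges I"
  shows "correlation I \<beta> \<gamma> i j = weight I {i, j} * edge_gain (triangle_sign I) \<beta> \<gamma>"
proof -
  obtain us where "ring I (us @ [i, j])"
    using ring_ending[OF assms] .
  then interpret ring_end I us i j by unfold_locales
  show ?thesis by (rule correlation)
qed

lemma qaoa_energy_eq_sum:
  "qaoa_energy I \<beta> \<gamma> =
     (\<Sum>e\<in>edges I. weight I e * expect (verts I) (qaoa_state I \<beta> \<gamma>) (Z_prod e))"
proof -
  let ?\<psi> = "qaoa_state I \<beta> \<gamma>"
  have "(\<Sum>x\<in>spins (verts I). cnj (?\<psi> x) * hamiltonian I ?\<psi> x) =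
      (\<Sum>e\<in>edges I. complex_of_real (weight I e) * (\<Sum>x\<in>spins (verts I). cnj (?\<psi> x) * Z_prod e ?\<psi> x))"
    unfolding hamiltonian_def sum_distrib_left by (subst sum.swap) (simp add: mult_ac)
  then show ?thesis
    by (simp add: qaoa_energy_def expect_def)
qed

lemma ring_energy:
  assumes "ring I vs"
  shows "qaoa_energy I \<beta> \<gamma> = card (edges I) * edge_gain (triangle_sign I) \<beta> \<gamma>"
proof -
  have "weight I e * expect (verts I) (qaoa_state I \<beta> \<gamma>) (Z_prod e) = edge_gain (triangle_sign I) \<beta> \<gamma>"
    if e: "e \<in> edges I" for e
  proof -
    obtain i j where ij: "i \<noteq> j" "e = {i, j}"
      using ring_edge[OF assms e] by blast
    have "expect (verts I) (qaoa_state I \<beta> \<gamma>) (Z_prod e) = weight I e * edge_gain (triangle_sign I) \<beta> \<gamma>"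
      using ring_correlation[OF assms, of i j \<beta> \<gamma>] ij e by (simp add: correlation_def Z_prod_edge)
    moreover have "weight I e * weight I e = 1"
      using ring_weight[OF assms e] by auto
    ultimately show ?thesis by simp
  qed
  then show ?thesis
    by (simp add: qaoa_energy_eq_sum)
qed

section \<open>Maximizing the gain over the angles\<close>

lemma edge_gain_le:
  assumes "\<kappa> \<in> {-1, 0, 1}"
  shows "edge_gain \<kappa> \<beta> \<gamma> \<le> 1 / (2 - \<kappa>)"
proof -
  define P Q where "P = sin (2*\<beta>) * sin (2*\<gamma>)" and "Q = cos (2*\<beta>) * cos (2*\<gamma>)"
  \<comment> \<open>\<open>Q + P\<close> and \<open>Q - P\<close> are the cosines of the difference
    and of the sum of the two angles.\<close>
  have "Q + P \<le> 1" "Q - P \<le> 1" "- Q + P \<le> 1" "- Q - P \<le> 1"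
    using cos_le_one[of "2*\<beta> - 2*\<gamma>"] cos_le_one[of "2*\<beta> + 2*\<gamma>"]
      cos_ge_minus_one[of "2*\<beta> - 2*\<gamma>"] cos_ge_minus_one[of "2*\<beta> + 2*\<gamma>"]
    by (simp_all add: P_def Q_def cos_diff cos_add)
  then have "\<bar>Q\<bar> \<le> 1 - \<bar>P\<bar>" by linarith
  then have "\<bar>P\<bar> * \<bar>Q\<bar> \<le> \<bar>P\<bar> * (1 - \<bar>P\<bar>)" by (intro mult_left_mono) auto
  moreover have "P * Q \<le> \<bar>P\<bar> * \<bar>Q\<bar>" by (simp add: abs_mult[symmetric])
  ultimately have "edge_gain \<kappa> \<beta> \<gamma> \<le> 2 * (\<bar>P\<bar> * (1 - \<bar>P\<bar>)) + \<kappa> * \<bar>P\<bar>\<^sup>2"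
    by (simp add: edge_gain_def P_def[symmetric] Q_def[symmetric])
  \<comment> \<open>Completing the square in \<open>\<bar>P\<bar>\<close>;
    \<open>2 - \<kappa>\<close> is positive.\<close>
  also have "\<dots> = 1 / (2 - \<kappa>) - (1 - (2 - \<kappa>) * \<bar>P\<bar>)\<^sup>2 / (2 - \<kappa>)"
    using assms by (auto simp: power2_eq_square field_simps)
  also have "\<dots> \<le> 1 / (2 - \<kappa>)"
    using assms by auto
  finally show ?thesis .
qed

lemma edge_gain_attained:
  assumes "\<kappa> \<in> {-1, 0, 1}"
  shows "\<exists>\<beta> \<gamma>. edge_gain \<kappa> \<beta> \<gamma> = 1 / (2 - \<kappa>)"
proof -
  \<comment> \<open>Equal angles give \<open>P = (sin \<theta>)\<^sup>2\<close> and
    \<open>Q = (cos \<theta>)\<^sup>2\<close>, so \<open>P + Q = 1\<close>; the choice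
    \<open>P = 1 / (2 - \<kappa>)\<close> makes the completed square of the upper bound
    vanish.\<close>
  define \<theta> where "\<theta> = arcsin (sqrt (1 / (2 - \<kappa>)))"
  have "0 \<le> 1 / (2 - \<kappa>)" "1 / (2 - \<kappa>) \<le> 1"
    using assms by auto
  then have s: "(sin \<theta>)\<^sup>2 = 1 / (2 - \<kappa>)"
    unfolding \<theta>_def by (subst sin_arcsin) (auto intro: order_trans[of _ 0])
  have "edge_gain \<kappa> (\<theta>/2) (\<theta>/2) = 2 * (sin \<theta>)\<^sup>2 * (1 - (sin \<theta>)\<^sup>2) + \<kappa> * ((sin \<theta>)\<^sup>2)\<^sup>2"
    unfolding cos_squared_eq[symmetric] by (simp add: edge_gain_def power2_eq_square mult_ac)
  also have "\<dots> = 1 / (2 - \<kappa>)"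
    using assms unfolding s by (auto simp: power2_eq_square)
  finally show ?thesis by blast
qed

lemma triangle_sign_cases: "ring I vs \<Longrightarrow> triangle_sign I \<in> {-1, 0, 1}"
proof -
  assume I: "ring I vs"
  have "\<bar>\<Prod>e\<in>edges I. weight I e\<bar> = (\<Prod>e\<in>edges I. \<bar>weight I e\<bar>)" by (simp add: abs_prod)
  also have "\<dots> = 1" using ring_weight[OF I] by (intro prod.neutral) force
  finally show ?thesis unfolding triangle_sign_def by auto
qed

lemma ring_qaoa_optimal_iff:
  assumes "ring I vs"
  shows "qaoa_optimal I \<beta> \<gamma> \<longleftrightarrow> edge_gain (triangle_sign I) \<beta> \<gamma> = 1 / (2 - triangle_sign I)"
proof -
  have "0 < real (card (edges I))"
    using ring_finite[OF assms] by (simp add: card_gt_0_iff)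
  then have "qaoa_optimal I \<beta> \<gamma> \<longleftrightarrow>
      (\<forall>\<beta>' \<gamma>'. edge_gain (triangle_sign I) \<beta>' \<gamma>' \<le> edge_gain (triangle_sign I) \<beta> \<gamma>)"
    by (simp add: qaoa_optimal_def ring_energy[OF assms])
  then show ?thesis
    using edge_gain_le[OF triangle_sign_cases[OF assms]] edge_gain_attained[OF triangle_sign_cases[OF assms]]
    by (metis order.antisym)
qed

lemma ring_optimal_correlation:
  assumes "ring I vs" "qaoa_optimal I \<beta> \<gamma>" "{i, j} \<in> edges I"
  shows "correlation I \<beta> \<gamma> i j = weight I {i, j} / (2 - triangle_sign I)"
  using assms ring_correlation ring_qaoa_optimal_iff by simp

lemma ring_optimal_correlation_sgn:
  assumes "ring I vs" "qaoa_optimal I \<beta> \<gamma>" "{i, j} \<in> edges I"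
  shows "sgn (correlation I \<beta> \<gamma> i j) = weight I {i, j}"
proof -
  have "weight I {i, j} \<in> {1, -1}" using assms by (auto simp: ring_def)
  then show ?thesis
    using triangle_sign_cases[OF assms(1)] by (auto simp: ring_optimal_correlation[OF assms])
qed

section \<open>Contraction of an edge\<close>

context ring_end
begin

abbreviation "s \<equiv> weight I {i, j}"
abbreviation "I' \<equiv> substitute i j s I"

lemma edges_avoiding: "e \<in> edges I \<and> j \<notin> e \<longleftrightarrow> e \<in> insert {i, p} (path_edges us)"
  using edges path_avoids distinct_ends by auto

text \<open>Ensures that the sum in the weight of a contracted edge has at most one term.\<close>

lemma neighbours: "k \<notin> {i, j} \<and> {j, k} \<in> edges I \<longleftrightarrow> k = q"
  using edges path_avoids distinct_ends by (auto simp: doubleton_eq_iff)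

lemma verts_substitute: "verts I' = insert i (set us)"
  using verts ij_notin distinct_ends(1) by (auto simp: substitute_def)

lemma edges_substitute: "edges I' = path_edges us \<union> {{i, p}, {i, q}}"
proof -
  have "edges I' = {e. e \<in> edges I \<and> j \<notin> e} \<union> {{i, k} |k. k \<notin> {i, j} \<and> {j, k} \<in> edges I}"
    by (simp add: substitute_def)
  then show ?thesis
    unfolding edges_avoiding neighbours by auto
qed

text \<open>Two separate summands rather than one case distinction: for \<open>p = q\<close> both
  fall on the same edge.\<close>

lemma weight_substitute:
  "weight I' e = (if e \<in> insert {i, p} (path_edges us) then weight I e else 0)
     + (if e = {i, q} then s * weight I {j, q} else 0)"
proof -
  have "weight I' e = (if e \<in> edges I \<and> j \<notin> e then weight I e else 0)
      + (\<Sum>k | (k \<notin> {i, j} \<and> {j, k} \<in> edges I) \<and> e = {i, k}. s * weight I {j, k})"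
    by (simp add: substitute_def conj_assoc)
  also have "(\<Sum>k | (k \<notin> {i, j} \<and> {j, k} \<in> edges I) \<and> e = {i, k}. s * weight I {j, k}) =
      (\<Sum>k | k = q \<and> e = {i, k}. s * weight I {j, k})"
    unfolding neighbours ..
  also have "{k. k = q \<and> e = {i, k}} = (if e = {i, q} then {q} else {})" by auto
  finally show ?thesis
    unfolding edges_avoiding by simp
qed

lemma i_p_notin_path: "{i, p} \<notin> path_edges us" "{i, q} \<notin> path_edges us"
  using path_avoids by auto

text \<open>Beyond the triangle \<open>p \<noteq> q\<close>, so no two edges merge and the new
  coupling is a product of two signs. A triangle would leave a single edge, of weight 0 or
  \<plusminus>2.\<close>

lemma ring_substitute:
  assumes "card (verts I) \<noteq> 3"
  shows "ring I' (us @ [i])"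
  unfolding ring_def
proof (intro conjI)
  have "length us \<noteq> 1" "us \<noteq> []" using assms card_verts us by auto
  then show "3 \<le> length (us @ [i])"
    using assms ring card_verts by (cases us rule: rev_cases) (auto simp: Suc_le_eq)
  show "edges I' = cycle_edges (us @ [i])"
    using edges_substitute us by (simp add: cycle_edges_snoc p_def q_def)
  have "p \<noteq> q" using assms p_eq_q_iff by simp
  moreover have "s * weight I {j, q} = 1 \<or> s * weight I {j, q} = -1"
    using weights(1,3) by auto
  ultimately show "\<forall>e\<in>edges I'. weight I' e \<in> {1, -1}"
    using edges ring_weight[OF ring] i_p_notin_path distinct_ends
    by (auto simp: edges_substitute weight_substitute doubleton_eq_iff)
qed (use ring verts_substitute in \<open>auto simp: ring_def\<close>)

lemma cost_eq:
  "cost I x = offset I + (\<Sum>e\<in>path_edges us. weight I e * (\<Prod>v\<in>e. x v))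
     + s * (x i * x j) + weight I {i, p} * (x i * x p) + weight I {j, q} * (x j * x q)"
  using distinct_ends by (simp add: cost_def sum_edges)

lemma cost_substitute_eq:
  "cost I' y = offset I + s * s + (\<Sum>e\<in>path_edges us. weight I e * (\<Prod>v\<in>e. y v))
     + weight I {i, p} * (y i * y p) + s * weight I {j, q} * (y i * y q)"
proof -
  let ?P = "\<lambda>e. \<Prod>v\<in>e. y v"
  let ?E = "insert {i, p} (path_edges us)"
  have E: "edges I' = ?E \<union> {{i, q}}"
    using edges_substitute by auto
  have "(\<Sum>e\<in>edges I'. weight I' e * ?P e) =
      (\<Sum>e\<in>edges I'. (if e \<in> ?E then weight I e * ?P e else 0)) +
      (\<Sum>e\<in>edges I'. (if e = {i, q} then s * weight I {j, q} * ?P e else 0))"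
    unfolding sum.distrib[symmetric] weight_substitute
    by (intro sum.cong) (auto simp: distrib_right)
  also have "(\<Sum>e\<in>edges I'. (if e \<in> ?E then weight I e * ?P e else 0)) = (\<Sum>e\<in>?E. weight I e * ?P e)"
    unfolding E by (subst sum.inter_restrict[symmetric]) (auto intro!: sum.cong)
  also have "\<dots> = weight I {i, p} * (y i * y p) + (\<Sum>e\<in>path_edges us. weight I e * ?P e)"
    using i_p_notin_path distinct_ends by simp
  also have "(\<Sum>e\<in>edges I'. (if e = {i, q} then s * weight I {j, q} * ?P e else 0)) =
      s * weight I {j, q} * (y i * y q)"
    unfolding E using distinct_ends by (simp add: sum.delta)
  finally show ?thesis
    unfolding cost_def by (simp add: substitute_def)
qed

lemma sum_path_update:
  "(\<Sum>e\<in>path_edges us. weight I e * (\<Prod>v\<in>e. (x(j := t)) v)) =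
   (\<Sum>e\<in>path_edges us. weight I e * (\<Prod>v\<in>e. x v))"
proof (intro sum.cong refl)
  fix e assume "e \<in> path_edges us"
  then have "j \<notin> e" using path_avoids by auto
  then have "(\<Prod>v\<in>e. (x(j := t)) v) = (\<Prod>v\<in>e. x v)"
    by (intro prod.cong) auto
  then show "weight I e * (\<Prod>v\<in>e. (x(j := t)) v) = weight I e * (\<Prod>v\<in>e. x v)" by simp
qed

text \<open>As \<open>y i\<close> squares to 1, the term of the contracted edge becomes
  \<open>s * s\<close>, the amount added to the offset.\<close>

lemma cost_extend:
  assumes "y \<in> spins (verts I')"
  shows "cost I (y(j := s * y i)) = cost I' y"
proof -
  have "y i * y i = 1"
    using assms spins_sq verts_substitute by auto
  then have sq: "s * (y i * (s * y i)) = s * s"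
    by (simp add: mult.left_commute)
  have "cost I (y(j := s * y i)) = offset I + (\<Sum>e\<in>path_edges us. weight I e * (\<Prod>v\<in>e. y v))
      + s * (y i * (s * y i)) + weight I {i, p} * (y i * y p) + weight I {j, q} * (s * y i * y q)"
    unfolding cost_eq sum_path_update using distinct_ends by simp
  then show ?thesis
    unfolding sq cost_substitute_eq by (simp add: mult_ac)
qed

lemma extend_spins:
  assumes "y \<in> spins (verts I')"
  shows "y(j := s * y i) \<in> spins (verts I)"
proof -
  have "s * y i = 1 \<or> s * y i = -1"
    using weights(1) spins_cases[OF assms, of i] verts_substitute by auto
  then show ?thesis
    using assms unfolding spins_def verts verts_substitute by (auto simp: PiE_iff extensional_def)
qed

text \<open>
  If \<open>x\<close> violates the edge \<open>{i, j}\<close>, flipping \<open>x\<^sub>j\<close> gains 2 there and loses at most 2 at the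
  only other edge at \<open>j\<close>.
\<close>

lemma cost_le_substitute:
  assumes x: "x \<in> spins (verts I)"
  shows "\<exists>y\<in>spins (verts I'). cost I x \<le> cost I' y"
proof -
  define x' where "x' = x(j := s * x i)"
  \<comment> \<open>Assignments are \<open>undefined\<close> outside their vertices, so dropping the
    variable \<open>x j\<close> means resetting it.\<close>
  define y where "y = x(j := undefined)"
  have y: "y \<in> spins (verts I')"
    using x ij_notin distinct_ends(1) unfolding y_def spins_def verts verts_substitute
    by (auto simp: PiE_iff extensional_def)
  have "y(j := s * y i) = x'"
    using distinct_ends(1) by (auto simp: y_def x'_def)
  then have cost: "cost I' y = cost I x'"
    using cost_extend[OF y] by simp
  have sg: "x i = 1 \<or> x i = -1" "x j = 1 \<or> x j = -1" "x q = 1 \<or> x q = -1"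
    using spins_cases[OF x, of i] spins_cases[OF x, of j] spins_cases[OF x, of q] q_in
    by (simp_all add: verts)
  have "cost I x' - cost I x = s * (x i * (s * x i)) - s * (x i * x j)
      + weight I {j, q} * (s * x i * x q) - weight I {j, q} * (x j * x q)"
    using distinct_ends unfolding cost_eq x'_def sum_path_update by simp
  also have "\<dots> \<ge> 0"
    using sg weights(1,3) by auto
  finally show ?thesis
    using y cost by (intro bexI[of _ y]) simp_all
qed

end

section \<open>Runs of RQAOA\<close>

lemma rqaoa_step_ring:
  assumes "ring I vs" "rqaoa_step n_c (I, cs) (I', cs')"
  obtains us i j where "ring I (us @ [i, j])" "I' = substitute i j (weight I {i, j}) I"
    "cs' = (i, j, weight I {i, j}) # cs"
  using assms(2)
proof cases
  case (1 \<beta> \<gamma> i j s)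
  obtain us where "ring I (us @ [i, j])"
    using ring_ending[OF assms(1) \<open>{i, j} \<in> edges I\<close>] .
  moreover have "s = weight I {i, j}"
    using 1 ring_optimal_correlation_sgn[OF assms(1)] by auto
  ultimately show ?thesis
    using that 1 by blast
qed

lemma rqaoa_step_exists:
  assumes I: "ring I vs" and "n_c < card (verts I)"
  shows "\<exists>S. rqaoa_step n_c (I, cs) S"
proof -
  obtain \<beta> \<gamma> where opt: "qaoa_optimal I \<beta> \<gamma>"
    using edge_gain_attained[OF triangle_sign_cases[OF I]] ring_qaoa_optimal_iff[OF I] by blast
  obtain i j where ij: "i \<noteq> j" "{i, j} \<in> edges I"
    using ring_finite[OF I] ring_edge[OF I] by blast
  \<comment> \<open>All edges tie in absolute correlation, so every one of them is an admissible
    choice.\<close>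
  have abs: "\<bar>correlation I \<beta> \<gamma> a b\<bar> = 1 / \<bar>2 - triangle_sign I\<bar>" if "{a, b} \<in> edges I" for a b
    using ring_weight[OF I that] by (auto simp: ring_optimal_correlation[OF I opt that])
  have "rqaoa_step n_c (I, cs) (substitute i j (sgn (correlation I \<beta> \<gamma> i j)) I,
      (i, j, sgn (correlation I \<beta> \<gamma> i j)) # cs)"
    using assms(2) opt ij by (intro rqaoa_step.intros[where \<beta> = \<beta> and \<gamma> = \<gamma>]) (simp_all add: abs)
  then show ?thesis by blast
qed

text \<open>The second clause bounds the maximum of the current instance by that of
  \<open>I0\<close>, the third gives the converse; so \<open>recover\<close> maps maximizers to
  maximizers. In the first clause, two vertices are what remains of a contracted triangle.\<close>

definition rqaoa_invariant :: "ising \<Rightarrow> rqaoa_state \<Rightarrow> bool" where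
  "rqaoa_invariant I0 = (\<lambda>(I, cs).
     (card (verts I) = 2 \<or> (\<exists>vs. ring I vs)) \<and>
     (\<forall>y\<in>spins (verts I). recover cs y \<in> spins (verts I0) \<and> cost I0 (recover cs y) = cost I y) \<and>
     (\<forall>x\<in>spins (verts I0). \<exists>y\<in>spins (verts I). cost I0 x \<le> cost I y))"

lemma rqaoa_invariantD:
  assumes "rqaoa_invariant I0 (I, cs)"
  shows "card (verts I) = 2 \<or> (\<exists>vs. ring I vs)"
    and "y \<in> spins (verts I) \<Longrightarrow> recover cs y \<in> spins (verts I0)"
    and "y \<in> spins (verts I) \<Longrightarrow> cost I0 (recover cs y) = cost I y"
    and "x \<in> spins (verts I0) \<Longrightarrow> \<exists>y\<in>spins (verts I). cost I0 x \<le> cost I y"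
  using assms by (simp_all add: rqaoa_invariant_def)

lemma rqaoa_invariant_step:
  assumes inv: "rqaoa_invariant I0 (I, cs)" and "2 \<le> n_c"
    and step: "rqaoa_step n_c (I, cs) (I', cs')"
  shows "rqaoa_invariant I0 (I', cs')" "card (verts I') < card (verts I)"
proof -
  have "n_c < card (verts I)"
    using step by cases
  \<comment> \<open>More than \<open>n_c \<ge> 2\<close> vertices exclude the two-vertex
    alternative.\<close>
  then obtain vs where I: "ring I vs"
    using rqaoa_invariantD(1)[OF inv] \<open>2 \<le> n_c\<close> by auto
  obtain us i j where ending: "ring I (us @ [i, j])" and I': "I' = substitute i j (weight I {i, j}) I"
    and cs': "cs' = (i, j, weight I {i, j}) # cs"
    using rqaoa_step_ring[OF I step] .
  interpret ring_end I us i j by unfold_locales (rule ending)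
  have "card (verts I) = Suc (card (verts I'))"
    using card_verts verts_substitute ij_notin ring distinct_card[of us] by (simp add: I' ring_def)
  then show "card (verts I') < card (verts I)" by simp
  have "card (verts I') = 2 \<or> (\<exists>vs. ring I' vs)"
    using ring_substitute \<open>card (verts I) = Suc (card (verts I'))\<close> I' by auto
  moreover have "recover cs' y \<in> spins (verts I0) \<and> cost I0 (recover cs' y) = cost I' y"
    if "y \<in> spins (verts I')" for y
    using rqaoa_invariantD(2,3)[OF inv extend_spins] cost_extend that by (simp add: I' cs')
  moreover have "\<exists>y\<in>spins (verts I'). cost I0 x \<le> cost I' y" if x: "x \<in> spins (verts I0)" for x
  proof -
    obtain w where w: "w \<in> spins (verts I)" "cost I0 x \<le> cost I w"
      using rqaoa_invariantD(4)[OF inv x] by blast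
    moreover obtain y where "y \<in> spins (verts I')" "cost I w \<le> cost I' y"
      using cost_le_substitute[OF w(1)] I' by blast
    ultimately show ?thesis
      by (meson order_trans)
  qed
  ultimately show "rqaoa_invariant I0 (I', cs')"
    by (simp add: rqaoa_invariant_def)
qed

lemma rqaoa_invariant_start: "ring I vs \<Longrightarrow> rqaoa_invariant I (rqaoa_start I)"
  by (auto simp: rqaoa_invariant_def rqaoa_start_def)

lemma rqaoa_invariant_reachable:
  assumes "(rqaoa_step n_c)\<^sup>*\<^sup>* S T" "rqaoa_invariant I0 S" "2 \<le> n_c"
  shows "rqaoa_invariant I0 T"
  using assms(1)
proof induction
  case (step T U)
  then show ?case
    using rqaoa_invariant_step(1)[OF _ assms(3)] by (cases T; cases U) blast
qed (rule assms(2))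

text \<open>Infinite sets have cardinality 0, so the two-vertex alternative forces finiteness as
  well.\<close>

lemma rqaoa_invariant_finite: "rqaoa_invariant I0 (I, cs) \<Longrightarrow> finite (verts I)"
  using rqaoa_invariantD(1) ring_finite card_ge_0_finite by fastforce

lemma spins_nonempty: "spins V \<noteq> {}"
  by (simp add: spins_def PiE_eq_empty_iff)

text \<open>Above the threshold a step exists and removes a vertex; otherwise a maximum exists
  because the assignments form a finite nonempty set.\<close>

lemma rqaoa_terminates:
  assumes "rqaoa_invariant I0 (I, cs)" "2 \<le> n_c"
  shows "\<exists>x. rqaoa_returns n_c (I, cs) x"
  using assms(1)
proof (induction "card (verts I)" arbitrary: I cs rule: less_induct)
  case less
  show ?case
  proof (cases "n_c < card (verts I)")
    case True
    then obtain vs where "ring I vs"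
      using rqaoa_invariantD(1)[OF less.prems] assms(2) by auto
    then obtain I' cs' where step: "rqaoa_step n_c (I, cs) (I', cs')"
      using rqaoa_step_exists[OF _ True, of vs cs] by auto
    then obtain x where "rqaoa_returns n_c (I', cs') x"
      using less.hyps rqaoa_invariant_step[OF less.prems assms(2) step] by blast
    then show ?thesis
      using converse_rtranclp_into_rtranclp[of "rqaoa_step n_c", OF step]
      unfolding rqaoa_returns_def by blast
  next
    case False
    have "finite (spins (verts I))"
      using rqaoa_invariant_finite[OF less.prems] by (rule finite_spins)
    then obtain y where y: "y \<in> spins (verts I)"
      "cost I y = Max (cost I ` spins (verts I))"
      using Max_in[of "cost I ` spins (verts I)"] spins_nonempty by fastforce
    then have "\<forall>z\<in>spins (verts I). cost I z \<le> cost I y"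
      using \<open>finite (spins (verts I))\<close> by auto
    then show ?thesis
      using y False unfolding rqaoa_returns_def
      by (intro exI[of _ "recover cs y"] exI[of _ I] exI[of _ cs] exI[of _ y]) auto
  qed
qed

lemma rqaoa_returns_optimal:
  assumes "ring I vs" "2 \<le> n_c" "rqaoa_returns n_c (rqaoa_start I) x"
  shows "x \<in> spins (verts I) \<and> (\<forall>z\<in>spins (verts I). cost I z \<le> cost I x)"
proof -
  obtain I' cs y where reach: "(rqaoa_step n_c)\<^sup>*\<^sup>* (rqaoa_start I) (I', cs)"
    and y: "y \<in> spins (verts I')" "\<forall>z\<in>spins (verts I'). cost I' z \<le> cost I' y" and x: "x = recover cs y"
    using assms(3) unfolding rqaoa_returns_def by blast
  have inv: "rqaoa_invariant I (I', cs)"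
    using rqaoa_invariant_reachable[OF reach rqaoa_invariant_start[OF assms(1)] assms(2)] .
  then have "x \<in> spins (verts I)" "cost I x = cost I' y"
    using rqaoa_invariantD(2,3)[OF _ y(1)] by (simp_all add: x)
  moreover have "cost I z \<le> cost I' y" if z: "z \<in> spins (verts I)" for z
  proof -
    obtain w where "w \<in> spins (verts I')" "cost I z \<le> cost I' w"
      using rqaoa_invariantD(4)[OF inv z] by blast
    then show ?thesis using y(2) by force
  qed
  ultimately show ?thesis by auto
qed

section \<open>The ring on \<open>0, ..., n - 1\<close> as an instance\<close>

lemma path_edges_upt: "path_edges [0..<Suc m] = {{k, Suc k} |k. k < m}"
proof (induction m)
  case (Suc m)
  have "path_edges [0..<Suc (Suc m)] = path_edges ([0..<Suc m] @ [Suc m])" by simp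
  also have "\<dots> = insert {m, Suc m} (path_edges [0..<Suc m])"
    by (subst path_edges_append) auto
  finally show ?case
    unfolding Suc by (auto simp: less_Suc_eq)
qed simp

lemma cycle_edges_upt:
  assumes "0 < n"
  shows "cycle_edges [0..<n] = {{k, Suc k mod n} |k. k < n}"
proof -
  obtain m where n: "n = Suc m" using assms by (cases n) auto
  have "cycle_edges [0..<n] = insert {m, 0} {{k, Suc k} |k. k < m}"
    unfolding cycle_edges_def n path_edges_upt by (simp del: upt_Suc)
  also have "{{k, Suc k} |k. k < m} = {{k, Suc k mod n} |k. k < m}"
    using n by fastforce
  also have "insert {m, 0} \<dots> = {{k, Suc k mod n} |k. k < n}"
  proof -
    have "{f k |k. k < Suc m} = insert (f m) {f k |k. k < m}" for f :: "nat \<Rightarrow> nat set"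
      by (auto simp: less_Suc_eq)
    from this[of "\<lambda>k. {k, Suc k mod n}"] show ?thesis
      by (simp add: n)
  qed
  finally show ?thesis .
qed

text \<open>Distinct indices with the same edge would be successors of each other, so 2 would vanish
  modulo \<open>n\<close>; this fails for \<open>n \<ge> 3\<close>.\<close>

lemma ring_edge_inj:
  assumes "3 \<le> n" "k < n" "l < n" "{k, Suc k mod n} = {l, Suc l mod n}"
  shows "k = l"
  using assms by (auto simp: doubleton_eq_iff mod_Suc split: if_splits)

lemma ring_edge_proper:
  assumes "3 \<le> n" "k < n" shows "k \<noteq> Suc k mod n"
  using assms by (auto simp: mod_Suc)

lemma ring_ising_weight:
  assumes "3 \<le> n" "k < n"
  shows "weight (ring_ising n J) {k, Suc k mod n} = J k"
proof -
  have "{l. l < n \<and> {k, Suc k mod n} = {l, Suc l mod n}} = {k}"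
    using assms ring_edge_inj[OF assms(1)] by blast
  then show ?thesis by (simp add: ring_ising_def)
qed

lemma ring_ring_ising:
  assumes "3 \<le> n" "\<forall>k<n. J k \<in> {1, -1}"
  shows "ring (ring_ising n J) [0..<n]"
proof -
  have "edges (ring_ising n J) = cycle_edges [0..<n]"
    using assms(1) cycle_edges_upt[of n] by (simp add: ring_ising_def)
  moreover have "weight (ring_ising n J) e \<in> {1, -1}" if "e \<in> edges (ring_ising n J)" for e
  proof -
    obtain k where "k < n" "e = {k, Suc k mod n}"
      using \<open>e \<in> edges (ring_ising n J)\<close> by (auto simp: ring_ising_def)
    then show ?thesis
      using assms ring_ising_weight[OF assms(1)] by simp
  qed
  ultimately show ?thesis
    using assms(1) by (auto simp: ring_def ring_ising_def)
qed

lemma cost_ring_ising: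
  assumes "3 \<le> n"
  shows "cost (ring_ising n J) x = ring_cost n J x"
proof -
  let ?e = "\<lambda>k. {k, Suc k mod n}"
  have "edges (ring_ising n J) = ?e ` {..<n}"
    by (auto simp: ring_ising_def)
  moreover have "inj_on ?e {..<n}"
    using ring_edge_inj[OF assms] by (intro inj_onI) auto
  ultimately have "cost (ring_ising n J) x = (\<Sum>k<n. weight (ring_ising n J) (?e k) * (\<Prod>v\<in>?e k. x v))"
    by (simp add: cost_def sum.reindex) (simp add: ring_ising_def)
  also have "\<dots> = ring_cost n J x"
    unfolding ring_cost_def
    using ring_edge_proper[OF assms] ring_ising_weight[OF assms] by (intro sum.cong) simp_all
  finally show ?thesis .
qed

text \<open>Correctness alone would hold vacuously if runs could get stuck; the first conjunct
  therefore demands that every partial run can be completed, whatever was chosen before.\<close>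

theorem lemmaD2:
  fixes n n_c :: nat and J :: "nat \<Rightarrow> real"
  assumes "2 \<le> n_c" and "n_c < n"
    and "\<forall>k<n. J k \<in> {1, -1}"
  shows "(\<forall>S. (rqaoa_step n_c)\<^sup>*\<^sup>* (rqaoa_start (ring_ising n J)) S \<longrightarrow>
            (\<exists>x. rqaoa_returns n_c S x)) \<and>
         (\<forall>x. rqaoa_returns n_c (rqaoa_start (ring_ising n J)) x \<longrightarrow>
            x \<in> spins {..<n} \<and>
            ring_cost n J x = Max (ring_cost n J ` spins {..<n}))"
proof (intro conjI allI impI)
  have n: "3 \<le> n" using assms by simp
  note ring = ring_ring_ising[OF n assms(3)]
  fix S assume "(rqaoa_step n_c)\<^sup>*\<^sup>* (rqaoa_start (ring_ising n J)) S"
  then have "rqaoa_invariant (ring_ising n J) S"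
    using rqaoa_invariant_reachable rqaoa_invariant_start[OF ring] assms(1) by blast
  then show "\<exists>x. rqaoa_returns n_c S x"
    using rqaoa_terminates assms(1) by (cases S) blast
next
  have n: "3 \<le> n" using assms by simp
  fix x assume "rqaoa_returns n_c (rqaoa_start (ring_ising n J)) x"
  then have "x \<in> spins (verts (ring_ising n J)) \<and>
      (\<forall>z\<in>spins (verts (ring_ising n J)). cost (ring_ising n J) z \<le> cost (ring_ising n J) x)"
    using rqaoa_returns_optimal[OF ring_ring_ising[OF n assms(3)] assms(1)] by blast
  then have x: "x \<in> spins {..<n}" "\<forall>z\<in>spins {..<n}. ring_cost n J z \<le> ring_cost n J x"
    unfolding cost_ring_ising[OF n] by (simp_all add: ring_ising_def)
  then show "x \<in> spins {..<n}" by simp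
  show "ring_cost n J x = Max (ring_cost n J ` spins {..<n})"
    using x finite_spins[of "{..<n}"] by (intro Max_eqI[symmetric]) auto
qed

end
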